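(* Let $\Omega$ be a compact manifold with probability ergodic measure $\mu$ and let $g_t:\Omega\to\Omega$ be a $C^1$ flow with $\sup_{t,\theta}\|\partial_tg_t(\theta)\|<\infty$. Let $H_\theta(t)=H(g_t(\theta))$ be the associated family of time-dependent Hamiltonians in a Hilbert space $\mathcal{H}$, with propagators $U_\theta(t,s)$ and generalized quasienergy operator $\tilde K$ on $L^2(\Omega,\mathcal{H},d\mu)$. Suppose $\tilde Kf^{(\lambda)}=\lambda f^{(\lambda)}$ with $\theta\mapsto f^{(\lambda)}(\theta)$ a $C^1$ map. Then for $\mu$-almost every $\theta$ one has $U_\theta(t,0)f^{(\lambda)}(\theta)\in\mathrm{dom}\,H_\theta(t)$ and $$\left\langle U_\theta(t,0)f^{(\lambda)}(\theta),H_\theta(t)U_\theta(t,0)f^{(\lambda)}(\theta)\right\rangle$$ is a bounded function of $t$. Moreover, if $H_\theta(t)=H_0+V(g_t(\theta))$ with $V(g_t(\theta))$ bounded and $\sup_{t,\theta}\|V(g_t(\theta))\|<\infty$, then the energy expectation $$\left\langle U_\theta(t,0)f^{(\lambda)}(\theta),H_0U_\theta(t,0)f^{(\lambda)}(\theta)\right\rangle$$ is also a bounded function of $t$ (for $\mu$-almost every $\theta$).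
   Context: Setting (Jauslin–Lebowitz formulation). $\mathcal{H}$ is a separable complex Hilbert space; $g_t$ is an invertible flow on the compact manifold $\Omega$ and $\mu$ is a probability measure on $\Omega$, invariant and ergodic for $g_t$. For $\theta\in\Omega$, $H_\theta=H(\theta)$ is a self-adjoint operator in $\mathcal{H}$ and $H_\theta(t)=H(g_t(\theta))$ (so $H_\theta(0)=H_\theta$); typically $H_\theta(t)=H_0+V(g_t(\theta))$, where $H_0$ is an unbounded positive self-adjoint operator with discrete spectrum. The norm $\|\partial_tg_t(\theta)\|$ is taken with respect to a fixed Riemannian metric on $\Omega$. It is assumed that the Schrödinger equation has well-defined unitary strongly continuous propagators: $U_\theta(t,r)U_\theta(r,s)=U_\theta(t,s)$, $U_\theta(t,t)=I$, $U_\theta(t+r,s+r)=U_{g_r(\theta)}(t,s)$, and for $\psi\in\mathrm{dom}\,H_\theta(s)$ one has $U_\theta(t,s)\psi\in\mathrm{dom}\,H_\theta(t)$ and $i\,\partial_tU_\theta(t,s)\psi=H_\theta(t)U_\theta(t,s)\psi$. The generalized quasienergy operator $\tilde K$ is the self-adjoint operator on $L^2(\Omega,\mathcal{H},d\mu)$ generating the unitary group $$(e^{-i\tilde Kt}f)_\theta=\mathcal{F}_{-t}U_\theta(t,0)f_\theta=U_\theta(0,-t)\mathcal{F}_{-t}f_\theta,\qquad \mathcal{F}_{-t}f_\theta=f_{g_{-t}(\theta)}.$$ It acts as $(\tilde Kf)_\theta=i\frac{d}{dt}f_{g_{-t}(\theta)}\big|_{t=0}+H_\theta f_\theta$ (in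 particular an eigenvector $f$ satisfies $f_\theta\in\mathrm{dom}\,H_\theta$ for $\mu$-a.e. $\theta$). Here $f_\theta$ and $f(\theta)$ denote the same thing. *)

theory Defs
  imports "HOL-Probability.Probability"
begin

section \<open>Complex Hilbert spaces\<close>

text \<open>
  The inner product is linear in its second argument. The real inner product of the superclass is
  its real part, so norm, topology and completeness are the library's.
\<close>

class complex_hilbert = real_inner + complete_space +
  fixes scaleC :: "complex \<Rightarrow> 'a \<Rightarrow> 'a"  (infixr "*\<^sub>C" 75)
    and cinner :: "'a \<Rightarrow> 'a \<Rightarrow> complex"
  assumes scaleC_add_right: "a *\<^sub>C (x + y) = a *\<^sub>C x + a *\<^sub>C y"
    and scaleC_add_left: "(a + b) *\<^sub>C x = a *\<^sub>C x + b *\<^sub>C x"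
    and scaleC_scaleC: "a *\<^sub>C (b *\<^sub>C x) = (a * b) *\<^sub>C x"
    and scaleC_of_real: "complex_of_real r *\<^sub>C x = r *\<^sub>R x"
    and cinner_commute: "cinner x y = cnj (cinner y x)"
    and cinner_add_right: "cinner x (y + z) = cinner x y + cinner x z"
    and cinner_scaleC_right: "cinner x (a *\<^sub>C y) = a * cinner x y"
    and Re_cinner: "Re (cinner x y) = inner x y"

definition clinear_on :: "'h::complex_hilbert set \<Rightarrow> ('h \<Rightarrow> 'h) \<Rightarrow> bool" where
  "clinear_on D T \<longleftrightarrow>
     (\<forall>x\<in>D. \<forall>y\<in>D. T (x + y) = T x + T y) \<and> (\<forall>a. \<forall>x\<in>D. T (a *\<^sub>C x) = a *\<^sub>C T x)"

definition csubspace :: "'h::complex_hilbert set \<Rightarrow> bool" where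
  "csubspace D \<longleftrightarrow> 0 \<in> D \<and> (\<forall>x\<in>D. \<forall>y\<in>D. x + y \<in> D) \<and> (\<forall>a. \<forall>x\<in>D. a *\<^sub>C x \<in> D)"

definition unitary_op :: "('h::complex_hilbert \<Rightarrow> 'h) \<Rightarrow> bool" where
  "unitary_op T \<longleftrightarrow> clinear_on UNIV T \<and> (\<forall>x y. cinner (T x) (T y) = cinner x y) \<and> surj T"

section \<open>Unbounded operators\<close>

text \<open>The values of \<open>op_app T\<close> outside \<open>op_dom T\<close> are irrelevant.\<close>

record 'h uop =
  op_dom :: "'h set"
  op_app :: "'h \<Rightarrow> 'h"

text \<open>
  The adjoint as a relation; it is single-valued for a densely defined operator. Self-adjointness
  is equality of the adjoint with the operator, domains included.
\<close>

definition adjoint_graph :: "'h::complex_hilbert uop \<Rightarrow> ('h \<times> 'h) set" where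
  "adjoint_graph T = {(x, z). \<forall>y\<in>op_dom T. cinner x (op_app T y) = cinner z y}"

definition self_adjoint :: "'h::complex_hilbert uop \<Rightarrow> bool" where
  "self_adjoint T \<longleftrightarrow>
     csubspace (op_dom T) \<and> clinear_on (op_dom T) (op_app T) \<and> closure (op_dom T) = UNIV \<and>
     adjoint_graph T = {(x, op_app T x) | x. x \<in> op_dom T}"

definition unbounded_op :: "'h::complex_hilbert uop \<Rightarrow> bool" where
  "unbounded_op T \<longleftrightarrow> \<not> (\<exists>C. \<forall>x\<in>op_dom T. norm (op_app T x) \<le> C * norm x)"

definition positive_op :: "'h::complex_hilbert uop \<Rightarrow> bool" where
  "positive_op T \<longleftrightarrow> (\<forall>x\<in>op_dom T. cinner x (op_app T x) \<in> \<real> \<and> 0 \<le> Re (cinner x (op_app T x)))"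

definition spectrum :: "'h::complex_hilbert uop \<Rightarrow> complex set" where
  "spectrum T = {z. \<not> (bij_betw (\<lambda>x. op_app T x - z *\<^sub>C x) (op_dom T) UNIV \<and>
                       (\<exists>C. \<forall>x\<in>op_dom T. norm x \<le> C * norm (op_app T x - z *\<^sub>C x)))}"

text \<open>
  The spectrum consists of isolated eigenvalues of finite multiplicity. The span is the real one,
  but a complex space is finite-dimensional over the reals iff it is so over the complex numbers.
\<close>

definition discrete_spectrum :: "'h::complex_hilbert uop \<Rightarrow> bool" where
  "discrete_spectrum T \<longleftrightarrow>
     (\<forall>z\<in>spectrum T. \<not> z islimpt spectrum T \<and>
        (\<exists>x\<in>op_dom T. x \<noteq> 0 \<and> op_app T x = z *\<^sub>C x) \<and>
        (\<exists>B. finite B \<and> {x \<in> op_dom T. op_app T x = z *\<^sub>C x} \<subseteq> span B))"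

text \<open>The operator identity \<open>T = T0 + W\<close> for an everywhere defined \<open>W\<close>.\<close>

definition is_op_sum :: "'h::complex_hilbert uop \<Rightarrow> 'h uop \<Rightarrow> ('h \<Rightarrow> 'h) \<Rightarrow> bool" where
  "is_op_sum T T0 W \<longleftrightarrow> op_dom T = op_dom T0 \<and> (\<forall>x\<in>op_dom T0. op_app T x = op_app T0 x + W x)"

section \<open>Manifolds\<close>

text \<open>
  The model space \<open>'e\<close> of the charts is a normed space with the Heine--Borel property, i.e. an
  arbitrary finite-dimensional one; unlike \<open>euclidean_space\<close> this includes dimension 0.
  Differentiability is required to first order only, so that every smooth atlas qualifies.
\<close>

type_synonym ('m, 'e) chart = "'m set \<times> ('m \<Rightarrow> 'e)"

definition C1_on :: "'a::real_normed_vector set \<Rightarrow> ('a \<Rightarrow> 'b::real_normed_vector) \<Rightarrow> bool" where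
  "C1_on W F \<longleftrightarrow> (\<exists>F'. (\<forall>x\<in>W. (F has_derivative blinfun_apply (F' x)) (at x)) \<and>
                     continuous_on W F')"

abbreviation chart_inv :: "('m, 'e) chart \<Rightarrow> 'e \<Rightarrow> 'm" where
  "chart_inv c \<equiv> inv_into (fst c) (snd c)"

definition C1_atlas ::
  "('m::topological_space, 'e::{real_normed_vector, heine_borel}) chart set \<Rightarrow> bool" where
  "C1_atlas A \<longleftrightarrow>
     (\<forall>c\<in>A. open (fst c) \<and> open (snd c ` fst c) \<and>
            homeomorphism (fst c) (snd c ` fst c) (snd c) (chart_inv c)) \<and>
     (\<Union>c\<in>A. fst c) = UNIV \<and>
     (\<forall>c\<in>A. \<forall>c'\<in>A. C1_on (snd c ` (fst c \<inter> fst c')) (snd c' \<circ> chart_inv c))"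

definition C1_map ::
  "('m::topological_space, 'e::{real_normed_vector, heine_borel}) chart set \<Rightarrow>
   ('m \<Rightarrow> 'h::real_normed_vector) \<Rightarrow> bool" where
  "C1_map A f \<longleftrightarrow> (\<forall>c\<in>A. C1_on (snd c ` fst c) (f \<circ> chart_inv c))"

text \<open>A flow that is jointly \<open>C\<^sup>1\<close> in time and position.\<close>

definition C1_flow ::
  "('m::topological_space, 'e::{real_normed_vector, heine_borel}) chart set \<Rightarrow>
   (real \<Rightarrow> 'm \<Rightarrow> 'm) \<Rightarrow> bool" where
  "C1_flow A g \<longleftrightarrow>
     g 0 = id \<and> (\<forall>s t. g (s + t) = g s \<circ> g t) \<and>
     continuous_on UNIV (\<lambda>(t, p). g t p) \<and>
     (\<forall>c\<in>A. \<forall>c'\<in>A.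
        C1_on {(t, x). x \<in> snd c ` fst c \<and> g t (chart_inv c x) \<in> fst c'}
              (\<lambda>(t, x). snd c' (g t (chart_inv c x))))"

text \<open>
  A Riemannian metric in local coordinates: \<open>G c p\<close> is the inner product at the point \<open>p\<close>, acting
  on the coordinate representations of tangent vectors in the chart \<open>c\<close>. The last condition is the
  tensorial transformation rule under a change of chart. On a manifold that is only \<open>C\<^sup>1\<close>,
  continuity is all the regularity of a metric that makes sense.
\<close>

definition riemannian_metric ::
  "('m::topological_space, 'e::{real_normed_vector, heine_borel}) chart set \<Rightarrow>
   (('m, 'e) chart \<Rightarrow> 'm \<Rightarrow> 'e \<Rightarrow> 'e \<Rightarrow> real) \<Rightarrow> bool" where
  "riemannian_metric A G \<longleftrightarrow>
     (\<forall>c\<in>A. \<forall>p\<in>fst c. bounded_bilinear (G c p) \<and> (\<forall>v w. G c p v w = G c p w v) \<and>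
                        (\<forall>v. v \<noteq> 0 \<longrightarrow> 0 < G c p v v)) \<and>
     (\<forall>c\<in>A. continuous_on (fst c \<times> UNIV) (\<lambda>(p, v, w). G c p v w)) \<and>
     (\<forall>c\<in>A. \<forall>c'\<in>A. \<forall>p\<in>fst c \<inter> fst c'. \<forall>L.
        ((snd c' \<circ> chart_inv c) has_derivative L) (at (snd c p)) \<longrightarrow>
        (\<forall>v w. G c p v w = G c' p (L v) (L w)))"

text \<open>
  The Riemannian norm of \<open>\<partial>\<^sub>t g\<^sub>t(p)\<close>, computed in a chart \<open>c\<close> around \<open>g\<^sub>t(p)\<close>; by the transformation
  rule it does not depend on \<open>c\<close>.
\<close>

definition flow_speed ::
  "(('m, 'e::real_normed_vector) chart \<Rightarrow> 'm \<Rightarrow> 'e \<Rightarrow> 'e \<Rightarrow> real) \<Rightarrow>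
   (real \<Rightarrow> 'm \<Rightarrow> 'm) \<Rightarrow> ('m, 'e) chart \<Rightarrow> real \<Rightarrow> 'm \<Rightarrow> real" where
  "flow_speed G g c t p =
     (let v = vector_derivative (\<lambda>s. snd c (g s p)) (at t) in sqrt (G c (g t p) v v))"

definition bounded_flow_speed ::
  "('m, 'e::real_normed_vector) chart set \<Rightarrow>
   (('m, 'e) chart \<Rightarrow> 'm \<Rightarrow> 'e \<Rightarrow> 'e \<Rightarrow> real) \<Rightarrow> (real \<Rightarrow> 'm \<Rightarrow> 'm) \<Rightarrow> bool" where
  "bounded_flow_speed A G g \<longleftrightarrow>
     bdd_above {flow_speed G g c t p | c t p. c \<in> A \<and> g t p \<in> fst c}"

section \<open>Invariant ergodic measures\<close>

definition ergodic_measure :: "'m::topological_space measure \<Rightarrow> (real \<Rightarrow> 'm \<Rightarrow> 'm) \<Rightarrow> bool" where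
  "ergodic_measure M g \<longleftrightarrow>
     prob_space M \<and> sets M = sets borel \<and>
     (\<forall>t. g t \<in> measurable M M \<and> distr M M (g t) = M) \<and>
     (\<forall>S\<in>sets M. (\<forall>t. g t -` S = S) \<longrightarrow> measure M S = 0 \<or> measure M S = 1)"

section \<open>Propagators and the quasienergy operator\<close>

text \<open>
  Here \<open>U p t s\<close> stands for \<open>U\<^sub>p(t, s)\<close>, and the Hamiltonian \<open>H\<^sub>p(t)\<close> is \<open>H (g t p)\<close>. Measurability in
  the last conjunct is what makes \<open>quasienergy_group\<close> below act on square-integrable functions.
\<close>

definition propagators ::
  "'m::topological_space measure \<Rightarrow> (real \<Rightarrow> 'm \<Rightarrow> 'm) \<Rightarrow>
   ('m \<Rightarrow> 'h::{complex_hilbert, second_countable_topology} uop) \<Rightarrow>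
   ('m \<Rightarrow> real \<Rightarrow> real \<Rightarrow> 'h \<Rightarrow> 'h) \<Rightarrow> bool" where
  "propagators M g H U \<longleftrightarrow>
     (\<forall>p t s. unitary_op (U p t s)) \<and>
     (\<forall>p x. continuous_on UNIV (\<lambda>(t, s). U p t s x)) \<and>
     (\<forall>p t r s. U p t r \<circ> U p r s = U p t s) \<and>
     (\<forall>p t. U p t t = id) \<and>
     (\<forall>p t s r. U p (t + r) (s + r) = U (g r p) t s) \<and>
     (\<forall>p s t. \<forall>x\<in>op_dom (H (g s p)).
        U p t s x \<in> op_dom (H (g t p)) \<and>
        (\<exists>D. ((\<lambda>t. U p t s x) has_vector_derivative D) (at t) \<and>
             \<i> *\<^sub>C D = op_app (H (g t p)) (U p t s x))) \<and>
     (\<forall>t s x. (\<lambda>p. U p t s x) \<in> borel_measurable M)"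

text \<open>Square-integrable functions, not yet identified up to null sets.\<close>

definition L2 :: "'m measure \<Rightarrow> ('m \<Rightarrow> 'h::{complex_hilbert, second_countable_topology}) set" where
  "L2 M = {f. f \<in> borel_measurable M \<and> integrable M (\<lambda>p. (norm (f p))\<^sup>2)}"

definition L2_norm ::
  "'m measure \<Rightarrow> ('m \<Rightarrow> 'h::{complex_hilbert, second_countable_topology}) \<Rightarrow> real" where
  "L2_norm M f = sqrt (integral\<^sup>L M (\<lambda>p. (norm (f p))\<^sup>2))"

text \<open>
  The unitary group with value \<open>F\<^sub>-\<^sub>t U\<^sub>p(t, 0) f\<^sub>p\<close> at \<open>p\<close>, where the shift \<open>F\<^sub>-\<^sub>t\<close> replaces \<open>p\<close> by
  \<open>g\<^sub>-\<^sub>t(p)\<close> throughout.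
\<close>

definition quasienergy_group ::
  "(real \<Rightarrow> 'm \<Rightarrow> 'm) \<Rightarrow> ('m \<Rightarrow> real \<Rightarrow> real \<Rightarrow> 'h \<Rightarrow> 'h) \<Rightarrow> real \<Rightarrow> ('m \<Rightarrow> 'h) \<Rightarrow> 'm \<Rightarrow> 'h" where
  "quasienergy_group g U t f = (\<lambda>p. U (g (- t) p) t 0 (f (g (- t) p)))"

text \<open>
  The graph of the self-adjoint generator \<open>K\<close> of the group \<open>e\<^sup>-\<^sup>i\<^sup>K\<^sup>t\<close>: by Stone's theorem, \<open>K f\<close> is the
  limit in \<open>L\<^sup>2\<close> of \<open>(i / t) (e\<^sup>-\<^sup>i\<^sup>K\<^sup>t f - f)\<close>, and the domain consists of all \<open>f\<close> for which this limit
  exists. The relation is invariant under changes of \<open>f\<close> and \<open>h\<close> on null sets.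
\<close>

definition quasienergy_op ::
  "'m measure \<Rightarrow> (real \<Rightarrow> 'm \<Rightarrow> 'm) \<Rightarrow>
   ('m \<Rightarrow> real \<Rightarrow> real \<Rightarrow> 'h \<Rightarrow> 'h::{complex_hilbert, second_countable_topology}) \<Rightarrow>
   (('m \<Rightarrow> 'h) \<times> ('m \<Rightarrow> 'h)) set" where
  "quasienergy_op M g U =
     {(f, h). f \<in> L2 M \<and> h \<in> L2 M \<and>
        ((\<lambda>t. L2_norm M (\<lambda>p. (\<i> / complex_of_real t) *\<^sub>C (quasienergy_group g U t f p - f p) - h p))
           \<longlongrightarrow> 0) (at 0)}"

end

theory Submission
  imports Defs
begin

text \<open>
  Being an eigenvector of the generator, \<open>f\<close> satisfies
  \<open>U\<^sub>\<theta>(t, 0) f(\<theta>) = exp(-i \<lambda> t) f(g\<^sub>t(\<theta>))\<close> for almost every \<open>\<theta>\<close> and, both sides being continuous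
  in \<open>t\<close>, for all \<open>t\<close> simultaneously. The right-hand side is differentiable in \<open>t\<close>, with a derivative
  that is bounded because \<open>f\<close> and its derivative along the flow are continuous on a compact
  manifold. Unitarity and self-adjointness turn differentiability of an orbit of the propagator
  into membership of its initial value in the domain of the Hamiltonian, and
  \<open>H\<^sub>\<theta>(t) U\<^sub>\<theta>(t, 0) f(\<theta>)\<close> is \<open>i\<close> times the bounded derivative.
\<close>

section \<open>Complex inner products\<close>

lemma cinner_add_left: "cinner (x + y) z = cinner x z + cinner y z"
  for x y z :: "'h::complex_hilbert"
  by (metis cinner_add_right cinner_commute complex_cnj_add)

lemma cinner_scaleC_left: "cinner (a *\<^sub>C x) y = cnj a * cinner x y"
  for x y :: "'h::complex_hilbert"
  by (metis cinner_commute cinner_scaleC_right complex_cnj_mult)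

lemma cinner_self: "cinner x x = complex_of_real ((norm x)\<^sup>2)"
  for x :: "'h::complex_hilbert"
proof (rule complex_eqI)
  show "Re (cinner x x) = Re (complex_of_real ((norm x)\<^sup>2))"
    by (simp add: Re_cinner power2_norm_eq_inner)
  show "Im (cinner x x) = Im (complex_of_real ((norm x)\<^sup>2))"
    using arg_cong[OF cinner_commute[of x x], of Im] by simp
qed

lemma norm_scaleC: "norm (a *\<^sub>C x) = cmod a * norm x"
  for x :: "'h::complex_hilbert"
proof -
  have "complex_of_real ((norm (a *\<^sub>C x))\<^sup>2) = (a * cnj a) * cinner x x"
    unfolding cinner_self[symmetric] by (simp add: cinner_scaleC_left cinner_scaleC_right)
  also have "\<dots> = complex_of_real ((cmod a * norm x)\<^sup>2)"
    by (simp only: complex_norm_square[symmetric] cinner_self power_mult_distrib of_real_mult of_real_power)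
  finally have "(norm (a *\<^sub>C x))\<^sup>2 = (cmod a * norm x)\<^sup>2"
    using of_real_eq_iff by blast
  then show ?thesis by (simp add: power2_eq_iff_nonneg)
qed

text \<open>The real Cauchy-Schwarz inequality controls only the real part of \<open>cinner\<close>.
  Multiplying \<open>y\<close> by the unimodular \<open>a\<close> makes the product real and
  nonnegative and leaves the norms alone.\<close>

lemma norm_cinner_le: "cmod (cinner x y) \<le> norm x * norm y"
  for x y :: "'h::complex_hilbert"
proof (cases "cinner x y = 0")
  case False
  define a where "a = cnj (sgn (cinner x y))"
  have a: "cmod a = 1"
    using False by (simp add: a_def norm_sgn)
  have "a * cinner x y = complex_of_real ((cmod (cinner x y))\<^sup>2) / complex_of_real (cmod (cinner x y))"
    by (simp only: complex_norm_square a_def sgn_eq complex_cnj_divide complex_cnj_complex_of_real)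
      (simp add: mult.commute)
  then have a': "a * cinner x y = complex_of_real (cmod (cinner x y))"
    by (simp add: power2_eq_square)
  have "cmod (cinner x y) = inner x (a *\<^sub>C y)"
    by (metis a' Re_cinner Re_complex_of_real cinner_scaleC_right)
  also have "\<dots> \<le> norm x * norm (a *\<^sub>C y)" by (rule norm_cauchy_schwarz)
  finally show ?thesis by (simp add: norm_scaleC a)
qed simp

lemma scaleR_scaleC: "r *\<^sub>R x = complex_of_real r *\<^sub>C x" for x :: "'h::complex_hilbert"
  by (simp add: scaleC_of_real)

text \<open>Conjugate linearity in the first argument is plain linearity over the reals, so the
  product rule for real derivatives becomes available for \<open>cinner\<close>.\<close>

lemma bounded_bilinear_cinner: "bounded_bilinear (cinner :: 'h::complex_hilbert \<Rightarrow> 'h \<Rightarrow> complex)"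
proof
  show "\<exists>K. \<forall>(x::'h) y. cmod (cinner x y) \<le> norm x * norm y * K"
    by (rule exI[of _ 1]) (simp add: norm_cinner_le)
qed (simp_all add: cinner_add_left cinner_add_right scaleR_scaleC cinner_scaleC_left
    cinner_scaleC_right scaleR_conv_of_real)

lemma bounded_bilinear_scaleC: "bounded_bilinear (scaleC :: complex \<Rightarrow> 'h::complex_hilbert \<Rightarrow> 'h)"
proof
  show "\<exists>K. \<forall>a (x::'h). norm (a *\<^sub>C x) \<le> cmod a * norm x * K"
    by (rule exI[of _ 1]) (simp add: norm_scaleC)
qed (simp_all add: scaleC_add_left scaleC_add_right scaleR_scaleC scaleC_scaleC
    scaleR_conv_of_real mult.commute)

lemmas scaleC_diff_left = bounded_bilinear.diff_left[OF bounded_bilinear_scaleC]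
lemmas scaleC_diff_right = bounded_bilinear.diff_right[OF bounded_bilinear_scaleC]

lemma scaleC_one: "1 *\<^sub>C x = x" for x :: "'h::complex_hilbert"
  by (metis of_real_1 scaleR_one scaleR_scaleC)

lemma unitary_op_norm: "unitary_op T \<Longrightarrow> norm (T x) = norm x"
  by (metis unitary_op_def Re_cinner norm_eq_sqrt_inner)

lemma unitary_op_bounded_linear:
  assumes "unitary_op T"
  shows "bounded_linear T"
proof
  show "T (x + y) = T x + T y" for x y
    using assms by (simp add: unitary_op_def clinear_on_def)
  show "T (r *\<^sub>R x) = r *\<^sub>R T x" for r x
    using assms by (simp add: unitary_op_def clinear_on_def scaleR_scaleC)
  show "\<exists>K. \<forall>x. norm (T x) \<le> norm x * K"
    by (rule exI[of _ 1]) (simp add: unitary_op_norm[OF assms])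
qed

section \<open>Derivatives along the flow\<close>

lemma C1_map_continuous:
  fixes f :: "'m::t2_space \<Rightarrow> 'h::real_normed_vector"
  assumes "C1_atlas A" "C1_map A f"
  shows "continuous_on UNIV f"
proof -
  have "isCont f p" for p
  proof -
    obtain c where c: "c \<in> A" "p \<in> fst c" using assms(1) unfolding C1_atlas_def by blast
    have op: "open (fst c)" and hom: "homeomorphism (fst c) (snd c ` fst c) (snd c) (chart_inv c)"
      using assms(1) c unfolding C1_atlas_def by blast+
    have "C1_on (snd c ` fst c) (f \<circ> chart_inv c)" using assms(2) c unfolding C1_map_def by blast
    then have "continuous_on (snd c ` fst c) (f \<circ> chart_inv c)"
      unfolding C1_on_def
      by (meson continuous_at_imp_continuous_on has_derivative_continuous)
    then have "continuous_on (fst c) ((f \<circ> chart_inv c) \<circ> snd c)"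
      using hom continuous_on_compose homeomorphism_cont1 by blast
    then have "continuous_on (fst c) f"
      by (rule continuous_on_eq) (use hom in \<open>simp add: homeomorphism_def\<close>)
    with op c show ?thesis by (simp add: continuous_on_eq_continuous_at)
  qed
  then show ?thesis by (simp add: continuous_at_imp_continuous_on)
qed

text \<open>At time 0 the flow fixes every point, so a single chart around \<open>p\<close> serves
  for source and image. In it the chain rule gives the derivative along the flow, which depends
  continuously on \<open>q\<close> and hence is bounded near \<open>p\<close>.\<close>

lemma flow_derivative_locally_bounded:
  fixes A :: "('m::topological_space, 'e::{real_normed_vector, heine_borel}) chart set"
    and f :: "'m \<Rightarrow> 'h::real_normed_vector"
  assumes A: "C1_atlas A" and g: "C1_flow A g" and f: "C1_map A f"
  shows "\<exists>N B. open N \<and> p \<in> N \<and>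
    (\<forall>q\<in>N. \<exists>D. ((\<lambda>s. f (g s q)) has_vector_derivative D) (at 0) \<and> norm D \<le> B)"
proof -
  obtain c where c: "c \<in> A" "p \<in> fst c" using A unfolding C1_atlas_def by blast
  define S where "S = snd c ` fst c"
  have op: "open (fst c)" and hom: "homeomorphism (fst c) S (snd c) (chart_inv c)"
    using A c unfolding C1_atlas_def S_def by blast+
  have inv: "chart_inv c (snd c q) = q" if "q \<in> fst c" for q
    using hom that by (simp add: homeomorphism_def)
  have g0: "g 0 q = q" for q using g by (simp add: C1_flow_def)
  have gc: "continuous_on UNIV (\<lambda>(t, p). g t p)" using g by (simp add: C1_flow_def)
  obtain F' where F': "\<And>x. x \<in> S \<Longrightarrow> ((f \<circ> chart_inv c) has_derivative blinfun_apply (F' x)) (at x)"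
      and F'c: "continuous_on S F'"
    using f c unfolding C1_map_def C1_on_def S_def by meson
  define W where "W = {(t, x). x \<in> S \<and> g t (chart_inv c x) \<in> fst c}"
  have "C1_on W (\<lambda>(t, x). snd c (g t (chart_inv c x)))"
    using g c unfolding C1_flow_def W_def S_def by blast
  then obtain P where P: "\<And>z. z \<in> W \<Longrightarrow>
        ((\<lambda>(t, x). snd c (g t (chart_inv c x))) has_derivative blinfun_apply (P z)) (at z)"
      and Pc: "continuous_on W P"
    unfolding C1_on_def by blast
  \<comment> \<open>The vector \<open>(1, 0)\<close> is the pure time direction, so
    \<open>P (0, snd c q) (1, 0)\<close> is the velocity of the flow at \<open>q\<close> in
    coordinates.\<close>
  define D where "D q = F' (snd c q) (P (0, snd c q) (1, 0))" for q
  have W0: "(0, snd c q) \<in> W" if "q \<in> fst c" for q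
    using that by (simp add: W_def S_def inv g0)
  have deriv: "((\<lambda>s. f (g s q)) has_vector_derivative D q) (at 0)" if q: "q \<in> fst c" for q
  proof -
    have "((\<lambda>s. (s, snd c q)) has_derivative (\<lambda>s. (s, 0))) (at (0::real))"
      by (intro derivative_eq_intros) auto
    from diff_chain_at[OF this, of "\<lambda>(t, x). snd c (g t (chart_inv c x))"] P[OF W0[OF q]]
    have 1: "((\<lambda>s. snd c (g s q)) has_derivative (\<lambda>s. P (0, snd c q) (s, 0))) (at 0)"
      by (simp add: o_def inv q)
    have "((f \<circ> chart_inv c) has_derivative blinfun_apply (F' (snd c q))) (at (snd c (g 0 q)))"
      using F'[of "snd c q"] q by (simp add: g0 S_def)
    from diff_chain_at[OF 1 this]
    have 2: "((\<lambda>s. f (chart_inv c (snd c (g s q)))) has_derivative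
        (\<lambda>s. F' (snd c q) (P (0, snd c q) (s, 0)))) (at 0)"
      by (simp add: o_def)
    have "(\<lambda>s. F' (snd c q) (P (0, snd c q) (s, 0))) = (\<lambda>s. s *\<^sub>R D q)"
    proof
      fix s :: real
      have "(s, 0) = s *\<^sub>R (1, 0::'e)" by simp
      then show "F' (snd c q) (P (0, snd c q) (s, 0)) = s *\<^sub>R D q"
        unfolding D_def by (metis blinfun.scaleR_right)
    qed
    with 2 have 3: "((\<lambda>s. f (chart_inv c (snd c (g s q)))) has_vector_derivative D q) (at 0)"
      by (simp add: has_vector_derivative_def)
    \<comment> \<open>The coordinate expression agrees with \<open>f (g s q)\<close> while
      \<open>g s q\<close> stays in the chart; by continuity this holds on an open set of times
      containing 0.\<close>
    have "continuous_on UNIV (\<lambda>s. g s q)"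
      using continuous_on_compose2[OF gc, of UNIV "\<lambda>s. (s, q)"]
      by (simp add: continuous_on_Pair)
    then have "open ((\<lambda>s. g s q) -` fst c)"
      using op open_vimage by blast
    then show ?thesis
      by (rule has_vector_derivative_transform_within_open[OF 3]) (auto simp: g0 q inv)
  qed
  have sc: "continuous_on (fst c) (snd c)" using hom homeomorphism_cont1 by blast
  have Fc: "continuous_on (fst c) (\<lambda>q. F' (snd c q))"
    by (rule continuous_on_compose2[OF F'c sc]) (auto simp: S_def)
  have "continuous_on (fst c) (\<lambda>q. (0::real, snd c q))"
    using sc by (intro continuous_on_Pair continuous_on_const)
  then have "continuous_on (fst c) (\<lambda>q. P (0, snd c q))"
    by (rule continuous_on_compose2[OF Pc]) (auto simp: W0)
  then have "continuous_on (fst c) D"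
    unfolding D_def by (intro blinfun.continuous_on Fc continuous_on_const)
  then have "continuous_on (fst c) (\<lambda>q. norm (D q))" by (rule continuous_on_norm)
  \<comment> \<open>The margin 1 makes the inequality strict at \<open>p\<close>, so the set is an
    open neighbourhood of \<open>p\<close>.\<close>
  then have "open ((\<lambda>q. norm (D q)) -` {..<norm (D p) + 1} \<inter> fst c)" (is "open ?N")
    using op continuous_on_open_vimage open_lessThan by blast
  moreover have "p \<in> ?N" using c by simp
  moreover have "\<exists>d. ((\<lambda>s. f (g s q)) has_vector_derivative d) (at 0) \<and> norm d \<le> norm (D p) + 1"
    if "q \<in> ?N" for q
    using deriv[of q] that by (intro exI[of _ "D q"]) simp
  ultimately show ?thesis by blast
qed

text \<open>By the group law a derivative at time \<open>t\<close> along the orbit of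
  \<open>p\<close> is one at time 0 along the orbit of \<open>g t p\<close>. Local bounds at time 0
  therefore suffice, and a finite subcover makes them uniform.\<close>

lemma flow_derivative_bounded:
  fixes f :: "'m::topological_space \<Rightarrow> 'h::real_normed_vector"
  assumes A: "C1_atlas A" and "compact (UNIV :: 'm set)" and g: "C1_flow A g" and f: "C1_map A f"
  obtains B where
    "\<And>t p. \<exists>D. ((\<lambda>s. f (g s p)) has_vector_derivative D) (at t) \<and> norm D \<le> B"
proof -
  define bd where "bd N B \<longleftrightarrow>
    (\<forall>q\<in>N. \<exists>D. ((\<lambda>s. f (g s q)) has_vector_derivative D) (at 0) \<and> norm D \<le> B)" for N B
  have loc: "\<exists>N B. open N \<and> p \<in> N \<and> bd N B" for p
    unfolding bd_def by (rule flow_derivative_locally_bounded[OF A g f])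
  obtain C where C: "C \<subseteq> {N. open N \<and> (\<exists>B. bd N B)}" "finite C" "UNIV \<subseteq> \<Union>C"
  proof (rule compactE[OF assms(2), of "{N. open N \<and> (\<exists>B. bd N B)}"])
    show "UNIV \<subseteq> \<Union> {N. open N \<and> (\<exists>B. bd N B)}" using loc by blast
  qed auto
  then have "\<forall>N\<in>C. \<exists>B. bd N B" by blast
  then obtain B where B: "\<forall>N\<in>C. bd N (B N)" using bchoice by metis
  define B' where "B' = Max (insert 0 (B ` C))"
  show ?thesis
  proof (rule that[of B'])
    fix t p
    obtain N where N: "N \<in> C" "g t p \<in> N" using C(3) by blast
    with B obtain D where D: "((\<lambda>s. f (g s (g t p))) has_vector_derivative D) (at 0)" "norm D \<le> B N"
      unfolding bd_def by blast
    have "g (s - t) (g t p) = g s p" for s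
    proof -
      have "g (s - t + t) = g (s - t) \<circ> g t"
        using g unfolding C1_flow_def by blast
      then show ?thesis by simp
    qed
    moreover have "((\<lambda>s. s - t) has_vector_derivative 1) (at t)"
      by (auto intro!: derivative_eq_intros)
    ultimately have "((\<lambda>s. f (g s p)) has_vector_derivative D) (at t)"
      using vector_diff_chain_at[of "\<lambda>s. s - t" 1 t "\<lambda>s. f (g s (g t p))" D] D(1)
      by (simp add: o_def)
    moreover have "B N \<le> B'" unfolding B'_def using C(2) N(1) by (intro Max_ge) auto
    ultimately show "\<exists>D. ((\<lambda>s. f (g s p)) has_vector_derivative D) (at t) \<and> norm D \<le> B'"
      using D(2) order_trans by blast
  qed
qed

section \<open>Eigenvectors of the quasienergy operator\<close>

text \<open>Propagators are assumed measurable in \<open>p\<close> for each fixed vector, whereas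
  the group applies them to a vector varying with \<open>p\<close>. Simple functions approximating
  \<open>u\<close> take finitely many values, which reduces the claim to fixed vectors; continuity
  of \<open>T p\<close> handles the limit.\<close>

lemma borel_measurable_continuous_apply:
  fixes T :: "'m \<Rightarrow> 'a::{metric_space, second_countable_topology} \<Rightarrow> 'b::metric_space"
    and u :: "'m \<Rightarrow> 'a"
  assumes T: "\<And>x. (\<lambda>p. T p x) \<in> borel_measurable M" and cont: "\<And>p. continuous_on UNIV (T p)"
    and u: "u \<in> borel_measurable M"
  shows "(\<lambda>p. T p (u p)) \<in> borel_measurable M"
proof -
  obtain F where F: "\<And>i. simple_function M (F i)" "\<And>p. p \<in> space M \<Longrightarrow> (\<lambda>i. F i p) \<longlonglongrightarrow> u p"
    using borel_measurable_implies_sequence_metric[OF u] by blast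
  show ?thesis
  proof (rule borel_measurable_LIMSEQ_metric)
    fix i
    have fin: "finite (F i ` space M)" using F(1) by (rule simple_functionD)
    have "F i \<in> measurable M (count_space (F i ` space M))"
      using simple_functionD(2)[OF F(1)] by (simp add: measurable_count_space_eq2[OF fin])
    with T show "(\<lambda>p. T p (F i p)) \<in> borel_measurable M"
      by (rule measurable_compose_countable'[where f = "\<lambda>x p. T p x"]) (rule countable_finite[OF fin])
  next
    fix p assume "p \<in> space M"
    then show "(\<lambda>i. T p (F i p)) \<longlonglongrightarrow> T p (u p)"
      using continuous_on_tendsto_compose[OF cont F(2)] by simp
  qed
qed

section \<open>Square-integrable functions, and a criterion for vanishing\<close>

lemma norm_add_square_le: "(norm (x + y))\<^sup>2 \<le> 2 * (norm x)\<^sup>2 + 2 * (norm y)\<^sup>2"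
  for x y :: "'a::real_normed_vector"
proof -
  have "(norm (x + y))\<^sup>2 \<le> (norm x + norm y)\<^sup>2"
    by (intro power_mono norm_triangle_ineq norm_ge_zero)
  also have "\<dots> \<le> 2 * (norm x)\<^sup>2 + 2 * (norm y)\<^sup>2"
    using sum_squares_bound[of "norm x" "norm y"] by (simp add: power2_sum)
  finally show ?thesis .
qed

lemma L2_scaleC:
  assumes "u \<in> L2 M"
  shows "(\<lambda>p. a *\<^sub>C u p) \<in> L2 M"
proof -
  have "continuous_on UNIV (\<lambda>x::'b. a *\<^sub>C x)"
    using bounded_bilinear.bounded_linear_right[OF bounded_bilinear_scaleC]
    by (rule linear_continuous_on)
  then have "(\<lambda>p. a *\<^sub>C u p) \<in> borel_measurable M"
    using assms by (intro borel_measurable_continuous_on[of "\<lambda>x. a *\<^sub>C x"]) (auto simp: L2_def)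
  then show ?thesis
    using assms by (simp add: L2_def norm_scaleC power_mult_distrib)
qed

lemma L2_add:
  assumes "u \<in> L2 M" "v \<in> L2 M"
  shows "(\<lambda>p. u p + v p) \<in> L2 M"
proof -
  have m: "(\<lambda>p. u p + v p) \<in> borel_measurable M"
    using assms by (intro borel_measurable_add) (simp_all add: L2_def)
  moreover have "integrable M (\<lambda>p. (norm (u p + v p))\<^sup>2)"
  proof (rule Bochner_Integration.integrable_bound)
    show "integrable M (\<lambda>p. 2 * (norm (u p))\<^sup>2 + 2 * (norm (v p))\<^sup>2)"
      using assms by (simp add: L2_def)
    show "(\<lambda>p. (norm (u p + v p))\<^sup>2) \<in> borel_measurable M" using m by simp
  qed (simp add: norm_add_square_le)
  ultimately show ?thesis by (simp add: L2_def)
qed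

lemma L2_diff:
  assumes "u \<in> L2 M" "v \<in> L2 M"
  shows "(\<lambda>p. u p - v p) \<in> L2 M"
  using L2_add[OF assms(1) L2_scaleC[OF assms(2), of "-1"]]
  by (simp add: scaleC_of_real[of "-1", simplified])

lemma L2_norm_square: "(L2_norm M u)\<^sup>2 = (\<integral>p. (norm (u p))\<^sup>2 \<partial>M)"
  by (simp add: L2_norm_def)

text \<open>In this squared form the triangle inequality follows from a pointwise estimate under the
  integral. Two summands of equal norm produce exactly the factor 4 that
  \<open>zero_of_doubling\<close> allows.\<close>

lemma L2_norm_square_add_le:
  assumes "u \<in> L2 M" "v \<in> L2 M"
  shows "(L2_norm M (\<lambda>p. u p + v p))\<^sup>2 \<le> 2 * (L2_norm M u)\<^sup>2 + 2 * (L2_norm M v)\<^sup>2"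
proof -
  have "(\<integral>p. (norm (u p + v p))\<^sup>2 \<partial>M) \<le> (\<integral>p. 2 * (norm (u p))\<^sup>2 + 2 * (norm (v p))\<^sup>2 \<partial>M)"
    using assms L2_add[OF assms] by (intro integral_mono) (auto simp: L2_def norm_add_square_le)
  also have "\<dots> = 2 * (\<integral>p. (norm (u p))\<^sup>2 \<partial>M) + 2 * (\<integral>p. (norm (v p))\<^sup>2 \<partial>M)"
    using assms by (simp add: L2_def)
  finally show ?thesis by (simp add: L2_norm_square)
qed

lemma L2_norm_scaleC: "L2_norm M (\<lambda>p. a *\<^sub>C u p) = cmod a * L2_norm M u"
  by (simp add: L2_norm_def norm_scaleC power_mult_distrib real_sqrt_mult)

lemma L2_norm_eq_0:
  assumes "u \<in> L2 M" "L2_norm M u = 0"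
  shows "AE p in M. u p = 0"
  using assms integral_nonneg_eq_0_iff_AE[of M "\<lambda>p. (norm (u p))\<^sup>2"]
  by (simp add: L2_def L2_norm_def)

text \<open>Applied to the square \<open>Q\<close> of a subadditive function, whence the factor 4.\<close>

lemma zero_of_doubling:
  fixes Q e :: "real \<Rightarrow> real"
  assumes nonneg: "\<And>t. 0 \<le> Q t" and doubling: "\<And>t. Q (2 * t) \<le> 4 * Q t"
    and small: "\<And>t. t \<noteq> 0 \<Longrightarrow> Q t \<le> t\<^sup>2 * e t" and lim: "(e \<longlongrightarrow> 0) (at 0)" and "t \<noteq> 0"
  shows "Q t = 0"
proof -
  have iter: "Q t \<le> 4 ^ n * Q (t / 2 ^ n)" for n
  proof (induction n)
    case (Suc n)
    have "4 ^ n * Q (t / 2 ^ n) \<le> 4 ^ n * (4 * Q (t / 2 ^ Suc n))"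
      using doubling[of "t / 2 ^ Suc n"] by (intro mult_left_mono) simp_all
    also have "\<dots> = 4 ^ Suc n * Q (t / 2 ^ Suc n)" by simp
    finally show ?case using Suc by (rule order_trans[rotated])
  qed simp
  \<comment> \<open>The factor \<open>4 ^ n\<close> lost by doubling \<open>n\<close> times is
    exactly cancelled by the square of \<open>t / 2 ^ n\<close>, leaving only the vanishing
    \<open>e\<close>.\<close>
  have le: "Q t \<le> t\<^sup>2 * e (t / 2 ^ n)" for n
  proof -
    have "4 ^ n * Q (t / 2 ^ n) \<le> 4 ^ n * ((t / 2 ^ n)\<^sup>2 * e (t / 2 ^ n))"
      using small[of "t / 2 ^ n"] \<open>t \<noteq> 0\<close> by simp
    also have "\<dots> = t\<^sup>2 * e (t / 2 ^ n)"
      by (simp add: power_divide power_mult[symmetric] mult.commute[of n] power_mult)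
    finally show ?thesis using iter[of n] by simp
  qed
  have "(\<lambda>n. t * (1 / 2) ^ n) \<longlonglongrightarrow> t * 0"
    by (intro tendsto_intros LIMSEQ_power_zero) simp
  then have "filterlim (\<lambda>n. t / 2 ^ n) (at 0) sequentially"
    using \<open>t \<noteq> 0\<close> by (auto simp: filterlim_at power_divide)
  then have "(\<lambda>n. t\<^sup>2 * e (t / 2 ^ n)) \<longlonglongrightarrow> t\<^sup>2 * 0"
    by (intro tendsto_intros filterlim_compose[OF lim])
  then have "Q t \<le> 0" using le by (intro LIMSEQ_le_const[of _ "0"]) auto
  with nonneg[of t] show ?thesis by simp
qed

section \<open>The unitary group on square-integrable functions and its eigenvectors\<close>

locale quasienergy_system =
  fixes M :: "'m::topological_space measure"
    and g :: "real \<Rightarrow> 'm \<Rightarrow> 'm"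
    and H :: "'m \<Rightarrow> 'h::{complex_hilbert, second_countable_topology} uop"
    and U :: "'m \<Rightarrow> real \<Rightarrow> real \<Rightarrow> 'h \<Rightarrow> 'h"
  assumes ergodic: "ergodic_measure M g"
    and propagators: "propagators M g H U"
    and flow_zero: "g 0 = id"
    and flow_add: "\<And>s t. g (s + t) = g s \<circ> g t"
begin

lemma measurable_flow [measurable]: "g t \<in> measurable M M"
  and distr_flow: "distr M M (g t) = M"
  using ergodic by (simp_all add: ergodic_measure_def)

lemma flow_comp: "g s (g t p) = g (s + t) p"
  by (simp add: flow_add)

lemma unitary_U: "unitary_op (U p t s)"
  and continuous_U: "continuous_on UNIV (\<lambda>(t, s). U p t s x)"
  and measurable_U: "(\<lambda>p. U p t s x) \<in> borel_measurable M"
  using propagators by (simp_all add: propagators_def)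

lemma U_comp: "U p t r (U p r s x) = U p t s x"
  and U_self: "U p t t x = x"
  and U_shift: "U p (t + r) (s + r) x = U (g r p) t s x"
proof -
  have "U p t r \<circ> U p r s = U p t s" "U p t t = id" "U p (t + r) (s + r) = U (g r p) t s"
    using propagators unfolding propagators_def by blast+
  then show "U p t r (U p r s x) = U p t s x" "U p t t x = x"
    "U p (t + r) (s + r) x = U (g r p) t s x"
    by (simp_all add: fun_eq_iff)
qed

lemma U_dom: "x \<in> op_dom (H (g s p)) \<Longrightarrow> U p t s x \<in> op_dom (H (g t p))"
  and U_deriv: "x \<in> op_dom (H (g s p)) \<Longrightarrow>
    \<exists>D. ((\<lambda>t. U p t s x) has_vector_derivative D) (at t) \<and> \<i> *\<^sub>C D = op_app (H (g t p)) (U p t s x)"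
  using propagators unfolding propagators_def by blast+

lemma L2_flow: "u \<in> L2 M \<Longrightarrow> (\<lambda>p. u (g t p)) \<in> L2 M"
  and L2_norm_flow: "u \<in> L2 M \<Longrightarrow> L2_norm M (\<lambda>p. u (g t p)) = L2_norm M u"
proof -
  assume u: "u \<in> L2 M"
  then have [measurable]: "u \<in> borel_measurable M" by (simp add: L2_def)
  show "(\<lambda>p. u (g t p)) \<in> L2 M"
    using u integrable_distr[of "g t" M M "\<lambda>p. (norm (u p))\<^sup>2"] by (simp add: L2_def distr_flow)
  show "L2_norm M (\<lambda>p. u (g t p)) = L2_norm M u"
    using integral_distr[of "g t" M M "\<lambda>p. (norm (u p))\<^sup>2"] by (simp add: L2_norm_def distr_flow)
qed

text \<open>The group applies a unitary operator in each fibre and then shifts along the flow; the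
  first preserves pointwise norms and the second preserves the measure.\<close>

lemma L2_quasienergy_group: "u \<in> L2 M \<Longrightarrow> quasienergy_group g U t u \<in> L2 M"
  and L2_norm_quasienergy_group:
    "u \<in> L2 M \<Longrightarrow> L2_norm M (quasienergy_group g U t u) = L2_norm M u"
proof -
  assume u: "u \<in> L2 M"
  have "(\<lambda>p. U p t 0 (u p)) \<in> borel_measurable M"
  proof (rule borel_measurable_continuous_apply[OF measurable_U])
    show "continuous_on UNIV (U p t 0)" for p
      using unitary_op_bounded_linear[OF unitary_U] by (rule linear_continuous_on)
    show "u \<in> borel_measurable M" using u by (simp add: L2_def)
  qed
  with u have L: "(\<lambda>p. U p t 0 (u p)) \<in> L2 M"
    by (simp add: L2_def unitary_op_norm[OF unitary_U])
  show "quasienergy_group g U t u \<in> L2 M"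
    unfolding quasienergy_group_def by (rule L2_flow[OF L])
  show "L2_norm M (quasienergy_group g U t u) = L2_norm M u"
    unfolding quasienergy_group_def using L2_norm_flow[OF L, of "- t"]
    by (simp add: L2_norm_def unitary_op_norm[OF unitary_U])
qed

text \<open>Relative to the base point \<open>q\<close>, time translation rewrites the propagator
  from 0 to \<open>s\<close> at \<open>g t q\<close> as the one from \<open>t\<close> to
  \<open>s + t\<close> at \<open>q\<close>, which composes with the one from 0 to
  \<open>t\<close>.\<close>

lemma quasienergy_group_add:
  "quasienergy_group g U (s + t) u = quasienergy_group g U s (quasienergy_group g U t u)"
proof
  fix p
  define q where "q = g (- (s + t)) p"
  have "g (- s) p = g t q" and "g (- t) (g (- s) p) = q"
    unfolding q_def flow_comp by (rule arg_cong[where f = "\<lambda>r. g r p"], simp)+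
  moreover have "U (g t q) s 0 x = U q (s + t) t x" for x
    using U_shift[of q s t 0 x] by simp
  ultimately show "quasienergy_group g U (s + t) u p
      = quasienergy_group g U s (quasienergy_group g U t u) p"
    unfolding quasienergy_group_def q_def[symmetric] by (simp add: U_comp)
qed

lemma quasienergy_group_diff_scaleC:
  "quasienergy_group g U t (\<lambda>p. u p - a *\<^sub>C v p) p
    = quasienergy_group g U t u p - a *\<^sub>C quasienergy_group g U t v p"
proof -
  have "U q t 0 (x - y) = U q t 0 x - U q t 0 y" for q x y
    using unitary_op_bounded_linear[OF unitary_U] by (intro linear_diff bounded_linear.linear)
  moreover have "U q t 0 (a *\<^sub>C x) = a *\<^sub>C U q t 0 x" for q x
    using unitary_U[of q t 0] by (simp add: unitary_op_def clinear_on_def)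
  ultimately show ?thesis by (simp add: quasienergy_group_def)
qed

text \<open>The defect \<open>d t\<close> between the two sides is \<open>o(t)\<close> in norm by
  the eigenvalue equation, while the group law expresses \<open>d (2 * t)\<close> as a sum of two
  isometric images of \<open>d t\<close>. Halving \<open>t\<close> repeatedly thus forces the defect
  to vanish.\<close>

lemma eigenvector_quasienergy_group:
  assumes eig: "(f, \<lambda>p. complex_of_real lam *\<^sub>C f p) \<in> quasienergy_op M g U"
  shows "AE p in M. quasienergy_group g U t f p = cis (- lam * t) *\<^sub>C f p"
proof -
  let ?T = "quasienergy_group g U"
  define w where "w t p = (\<i> / complex_of_real t) *\<^sub>C (?T t f p - f p) - complex_of_real lam *\<^sub>C f p"
    for t p
  define d where "d t p = ?T t f p - cis (- lam * t) *\<^sub>C f p" for t p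
  define Q where "Q t = (L2_norm M (d t))\<^sup>2" for t
  have f: "f \<in> L2 M" and w0: "((\<lambda>t. L2_norm M (w t)) \<longlongrightarrow> 0) (at 0)"
    using eig unfolding quasienergy_op_def w_def by auto
  have w: "w t \<in> L2 M" and d: "d t \<in> L2 M" for t
    unfolding w_def d_def by (intro L2_diff L2_scaleC L2_quasienergy_group f)+
  have doubling: "Q (2 * t) \<le> 4 * Q t" for t
  proof -
    have "d (2 * t) p = ?T t (d t) p + cis (- lam * t) *\<^sub>C d t p" for p
    proof -
      have "?T (2 * t) f p = ?T t (?T t f) p"
        using quasienergy_group_add[of t t f] by simp
      then show ?thesis
        unfolding d_def by (simp add: quasienergy_group_diff_scaleC scaleC_diff_right
            scaleC_scaleC cis_mult
            mult.left_commute)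
    qed
    then have "d (2 * t) = (\<lambda>p. ?T t (d t) p + cis (- lam * t) *\<^sub>C d t p)" by (rule ext)
    then have "Q (2 * t) = (L2_norm M (\<lambda>p. ?T t (d t) p + cis (- lam * t) *\<^sub>C d t p))\<^sup>2"
      by (simp only: Q_def)
    also have "\<dots> \<le> 2 * (L2_norm M (?T t (d t)))\<^sup>2
        + 2 * (L2_norm M (\<lambda>p. cis (- lam * t) *\<^sub>C d t p))\<^sup>2"
      by (intro L2_norm_square_add_le L2_scaleC L2_quasienergy_group d)
    also have "\<dots> = 4 * Q t"
      by (simp add: L2_norm_quasienergy_group d L2_norm_scaleC Q_def)
    finally show ?thesis .
  qed
  \<comment> \<open>The first term is the error of the difference quotient in the eigenvalue
    equation, the second the Taylor remainder of the phase divided by \<open>t\<close>.\<close>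
  define e where "e t = 2 * (L2_norm M (w t))\<^sup>2 + 2 * (lam\<^sup>2 * t / 2)\<^sup>2 * (L2_norm M f)\<^sup>2" for t
  have small: "Q t \<le> t\<^sup>2 * e t" if "t \<noteq> 0" for t
  proof -
    \<comment> \<open>The scalar \<open>a\<close> undoes the factor of the difference quotient and
      \<open>b\<close> is the first-order Taylor remainder of the phase up to sign, so that
      \<open>d t\<close> splits into \<open>a\<close> times \<open>w t\<close> and \<open>b\<close>
      times \<open>f\<close>.\<close>
    define b where "b = 1 - \<i> * complex_of_real (lam * t) - cis (- lam * t)"
    define a where "a = complex_of_real t / \<i>"
    have a: "a * (\<i> / complex_of_real t) = 1" "cmod a = \<bar>t\<bar>"
      using that by (simp_all add: a_def norm_divide norm_mult)
    have "d t p = a *\<^sub>C w t p + b *\<^sub>C f p" for p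
    proof -
      have "a *\<^sub>C w t p = ?T t f p - f p - (a * complex_of_real lam) *\<^sub>C f p"
        unfolding w_def by (simp only: scaleC_diff_right scaleC_scaleC a mult.assoc[symmetric])
          (simp add: scaleC_one scaleC_diff_right)
      moreover have "b = 1 + a * complex_of_real lam - cis (- lam * t)"
        by (simp add: a_def b_def)
      ultimately show ?thesis
        by (simp add: d_def scaleC_add_left scaleC_diff_left scaleC_one)
    qed
    then have "d t = (\<lambda>p. a *\<^sub>C w t p + b *\<^sub>C f p)" by (rule ext)
    then have "Q t = (L2_norm M (\<lambda>p. a *\<^sub>C w t p + b *\<^sub>C f p))\<^sup>2" by (simp only: Q_def)
    also have "\<dots> \<le> 2 * (L2_norm M (\<lambda>p. a *\<^sub>C w t p))\<^sup>2 + 2 * (L2_norm M (\<lambda>p. b *\<^sub>C f p))\<^sup>2"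
      by (intro L2_norm_square_add_le L2_scaleC w f)
    also have "\<dots> = 2 * t\<^sup>2 * (L2_norm M (w t))\<^sup>2 + 2 * (cmod b)\<^sup>2 * (L2_norm M f)\<^sup>2"
      by (simp add: L2_norm_scaleC a power_mult_distrib)
    also have "\<dots> \<le> 2 * t\<^sup>2 * (L2_norm M (w t))\<^sup>2 + 2 * ((lam * t)\<^sup>2 / 2)\<^sup>2 * (L2_norm M f)\<^sup>2"
    proof -
      have "cmod b \<le> (lam * t)\<^sup>2 / 2"
        using iexp_approx1[of "- lam * t" 1]
        by (simp add: b_def cis_conv_exp norm_minus_commute algebra_simps power2_eq_square)
      then show ?thesis by (intro add_left_mono mult_right_mono mult_left_mono power_mono) auto
    qed
    also have "\<dots> = t\<^sup>2 * e t" by (simp add: e_def algebra_simps power2_eq_square)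
    finally show ?thesis .
  qed
  have "(e \<longlongrightarrow> 2 * 0\<^sup>2 + 2 * (lam\<^sup>2 * 0 / 2)\<^sup>2 * (L2_norm M f)\<^sup>2) (at 0)"
    unfolding e_def by (intro tendsto_intros w0) auto
  then have lim: "(e \<longlongrightarrow> 0) (at 0)" by simp
  show ?thesis
  proof (cases "t = 0")
    case True
    then show ?thesis by (simp add: quasienergy_group_def flow_zero U_self scaleC_one)
  next
    case False
    have "Q t = 0"
      by (rule zero_of_doubling[OF _ doubling small lim False]) (simp add: Q_def)
    then have "AE p in M. d t p = 0" by (intro L2_norm_eq_0 d) (simp add: Q_def)
    then show ?thesis by (simp add: d_def)
  qed
qed

lemma eigenvector_orbit:
  assumes eig: "(f, \<lambda>p. complex_of_real lam *\<^sub>C f p) \<in> quasienergy_op M g U"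
    and cont: "\<And>p. continuous_on UNIV (\<lambda>t. f (g t p))"
  shows "AE p in M. \<forall>t. U p t 0 (f p) = cis (- lam * t) *\<^sub>C f (g t p)"
proof -
  have "AE p in M. U p t 0 (f p) = cis (- lam * t) *\<^sub>C f (g t p)" for t
  proof -
    \<comment> \<open>Invariance of the measure allows \<open>g t p\<close> in place of
      \<open>p\<close> in an almost-everywhere statement; the backward shift inside the group then
      cancels.\<close>
    have "AE p in distr M M (g t). quasienergy_group g U t f p = cis (- lam * t) *\<^sub>C f p"
      unfolding distr_flow by (rule eigenvector_quasienergy_group[OF eig])
    then have "AE p in M. quasienergy_group g U t f (g t p) = cis (- lam * t) *\<^sub>C f (g t p)"
      by (rule AE_distrD[OF measurable_flow])
    then show ?thesis by (simp add: quasienergy_group_def flow_comp flow_zero)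
  qed
  \<comment> \<open>The exceptional null set depends on \<open>t\<close>, and only countably many
    can be united. The good times form a closed set, which contains all reals once it contains the
    rationals.\<close>
  then have "AE p in M. \<forall>t\<in>\<rat>. U p t 0 (f p) = cis (- lam * t) *\<^sub>C f (g t p)"
    by (simp add: AE_ball_countable countable_rat)
  then show ?thesis
  proof (eventually_elim, intro allI)
    fix p t
    assume eq: "\<forall>t\<in>\<rat>. U p t 0 (f p) = cis (- lam * t) *\<^sub>C f (g t p)"
    have "continuous_on UNIV (\<lambda>t. U p t 0 (f p))"
      using continuous_on_compose2[OF continuous_U[of p "f p"], of UNIV "\<lambda>t. (t, 0)"]
      by (simp add: continuous_on_Pair)
    moreover have "continuous_on UNIV (\<lambda>t. cis (- lam * t) *\<^sub>C f (g t p))"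
      by (intro bounded_bilinear.continuous_on[OF bounded_bilinear_scaleC] cont continuous_intros)
    ultimately have "closed {t. U p t 0 (f p) = cis (- lam * t) *\<^sub>C f (g t p)}"
      by (rule closed_Collect_eq)
    moreover have "\<rat> \<subseteq> {t. U p t 0 (f p) = cis (- lam * t) *\<^sub>C f (g t p)}" using eq by blast
    ultimately have "closure \<rat> \<subseteq> {t. U p t 0 (f p) = cis (- lam * t) *\<^sub>C f (g t p)}"
      by (rule closure_minimal[rotated])
    then show "U p t 0 (f p) = cis (- lam * t) *\<^sub>C f (g t p)"
      using Rats_closure_real by blast
  qed
qed

section \<open>Differentiable orbits and the domain of the Hamiltonian\<close>

text \<open>
  If \<open>y\<close> is in the domain, differentiating the constant \<open>\<langle>U(t, 0) x, U(t, 0) y\<rangle>\<close> at \<open>t = 0\<close> gives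
  \<open>\<langle>x, H y\<rangle> = \<langle>i D, y\<rangle>\<close>, so \<open>x\<close> is in the domain of the adjoint.
\<close>

lemma differentiable_orbit_in_dom:
  assumes sa: "self_adjoint (H p)"
    and D: "((\<lambda>t. U p t 0 x) has_vector_derivative D) (at 0)"
  shows "x \<in> op_dom (H p)"
proof -
  have "cinner x (op_app (H p) y) = cinner (\<i> *\<^sub>C D) y" if y: "y \<in> op_dom (H p)" for y
  proof -
    obtain E where E: "((\<lambda>t. U p t 0 y) has_vector_derivative E) (at 0)"
        "\<i> *\<^sub>C E = op_app (H p) y"
      using U_deriv[of y 0 p 0] y by (auto simp: flow_zero U_self)
    have "((\<lambda>t. cinner (U p t 0 x) (U p t 0 y)) has_vector_derivative
        cinner (U p 0 0 x) E + cinner D (U p 0 0 y)) (at 0)"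
      by (rule bounded_bilinear.has_vector_derivative[OF bounded_bilinear_cinner D E(1)])
    moreover have "cinner (U p t 0 x) (U p t 0 y) = cinner x y" for t
      using unitary_U by (simp add: unitary_op_def)
    ultimately have "((\<lambda>t. cinner x y) has_vector_derivative cinner x E + cinner D y) (at (0::real))"
      by (simp add: U_self)
    then have "cinner x E + cinner D y = 0"
      using has_vector_derivative_const by (rule vector_derivative_unique_at)
    then have "cinner x E = - cinner D y" by (simp add: eq_neg_iff_add_eq_0)
    \<comment> \<open>The minus sign is absorbed when the imaginary unit moves into the first
      argument, where it is conjugated.\<close>
    then show ?thesis
      by (simp add: E(2)[symmetric] cinner_scaleC_right cinner_scaleC_left)
  qed
  then have "(x, \<i> *\<^sub>C D) \<in> adjoint_graph (H p)" by (simp add: adjoint_graph_def)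
  then show ?thesis using sa by (auto simp: self_adjoint_def)
qed

text \<open>Differentiability at time 0 puts \<open>x\<close> into the domain, and the propagators
  carry domains into domains. Uniqueness of derivatives then identifies the Hamiltonian applied to
  the orbit with the imaginary unit times \<open>D t\<close>, so its norm is at most
  \<open>B\<close>.\<close>

lemma energy_of_differentiable_orbit:
  assumes sa: "self_adjoint (H p)"
    and D: "\<And>t. ((\<lambda>t. U p t 0 x) has_vector_derivative D t) (at t)" and B: "\<And>t. norm (D t) \<le> B"
  shows "U p t 0 x \<in> op_dom (H (g t p))"
    and "cmod (cinner (U p t 0 x) (op_app (H (g t p)) (U p t 0 x))) \<le> norm x * B"
proof -
  have x: "x \<in> op_dom (H (g 0 p))"
    using differentiable_orbit_in_dom[OF sa D] by (simp add: flow_zero)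
  then show "U p t 0 x \<in> op_dom (H (g t p))" by (rule U_dom)
  obtain E where E: "((\<lambda>t. U p t 0 x) has_vector_derivative E) (at t)"
      "\<i> *\<^sub>C E = op_app (H (g t p)) (U p t 0 x)"
    using U_deriv[OF x] by blast
  have "E = D t" by (rule vector_derivative_unique_at[OF E(1) D])
  then have "norm (op_app (H (g t p)) (U p t 0 x)) \<le> B"
    using B[of t] by (simp add: E(2)[symmetric] norm_scaleC)
  then have "norm (U p t 0 x) * norm (op_app (H (g t p)) (U p t 0 x)) \<le> norm x * B"
    by (simp add: unitary_op_norm[OF unitary_U] mult_left_mono)
  with norm_cinner_le show "cmod (cinner (U p t 0 x) (op_app (H (g t p)) (U p t 0 x))) \<le> norm x * B"
    by (rule order_trans)
qed

end

section \<open>Energy expectations along the orbits of an eigenvector\<close>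

theorem theorem6:
  fixes A :: "('m::{t2_space, second_countable_topology}, 'e::{real_normed_vector, heine_borel}) chart set"
    and G :: "('m, 'e) chart \<Rightarrow> 'm \<Rightarrow> 'e \<Rightarrow> 'e \<Rightarrow> real"
    and M :: "'m measure"
    and g :: "real \<Rightarrow> 'm \<Rightarrow> 'm"
    and H :: "'m \<Rightarrow> 'h::{complex_hilbert, second_countable_topology} uop"
    and U :: "'m \<Rightarrow> real \<Rightarrow> real \<Rightarrow> 'h \<Rightarrow> 'h"
    and f :: "'m \<Rightarrow> 'h"
    and lam :: real
  assumes "C1_atlas A" and "compact (UNIV :: 'm set)" and "riemannian_metric A G"
    and "C1_flow A g" and "bounded_flow_speed A G g"
    and "ergodic_measure M g"
    and "\<And>\<theta>. self_adjoint (H \<theta>)"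
    and "propagators M g H U"
    and "(f, \<lambda>\<theta>. complex_of_real lam *\<^sub>C f \<theta>) \<in> quasienergy_op M g U"
    and "C1_map A f"
  shows "(AE \<theta> in M.
            (\<forall>t. U \<theta> t 0 (f \<theta>) \<in> op_dom (H (g t \<theta>))) \<and>
            bounded (range (\<lambda>t. cinner (U \<theta> t 0 (f \<theta>)) (op_app (H (g t \<theta>)) (U \<theta> t 0 (f \<theta>)))))) \<and>
         (\<forall>(H0 :: 'h uop) (V :: 'm \<Rightarrow> 'h \<Rightarrow> 'h).
            self_adjoint H0 \<and> unbounded_op H0 \<and> positive_op H0 \<and> discrete_spectrum H0 \<and>
            (\<forall>\<theta>. clinear_on UNIV (V \<theta>) \<and> bounded_linear (V \<theta>)) \<and>
            bdd_above {onorm (V (g t \<theta>)) | t \<theta>. True} \<and>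
            (\<forall>\<theta> t. is_op_sum (H (g t \<theta>)) H0 (V (g t \<theta>))) \<longrightarrow>
            (AE \<theta> in M.
               bounded (range (\<lambda>t. cinner (U \<theta> t 0 (f \<theta>)) (op_app H0 (U \<theta> t 0 (f \<theta>)))))))"
proof (intro conjI allI impI)
  have flow_zero: "g 0 = id" and flow_add: "\<And>s t. g (s + t) = g s \<circ> g t"
    and flow_cont: "continuous_on UNIV (\<lambda>(t, p). g t p)"
    using \<open>C1_flow A g\<close> unfolding C1_flow_def by blast+
  interpret quasienergy_system M g H U
    by unfold_locales (use assms flow_zero flow_add in auto)
  have f_cont: "continuous_on UNIV f"
    using \<open>C1_atlas A\<close> \<open>C1_map A f\<close> by (rule C1_map_continuous)
  have "continuous_on UNIV (\<lambda>t. g t p)" for p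
    using continuous_on_compose2[OF flow_cont, of UNIV "\<lambda>t. (t, p)"]
    by (simp add: continuous_on_Pair)
  then have "continuous_on UNIV (\<lambda>t. f (g t p))" for p
    by (rule continuous_on_compose2[OF f_cont]) simp
  with assms(9) have orbit:
    "AE p in M. \<forall>t. U p t 0 (f p) = cis (- lam * t) *\<^sub>C f (g t p)"
    by (rule eigenvector_orbit)
  obtain F where F: "\<And>p. norm (f p) \<le> F"
    using compact_imp_bounded[OF compact_continuous_image[OF f_cont assms(2)]]
    by (auto simp: bounded_iff)
  obtain B where B: "\<And>t p. \<exists>D. ((\<lambda>s. f (g s p)) has_vector_derivative D) (at t) \<and> norm D \<le> B"
    using flow_derivative_bounded[OF assms(1,2,4,10)] by blast
  \<comment> \<open>\<open>F\<close> bounds the state; differentiating the phase times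
    \<open>f (g t p)\<close> gives at most \<open>B\<close> from the flow and
    \<bar>\<open>lam\<close>\<bar> times \<open>F\<close> from the phase. The bound depends neither
    on \<open>t\<close> nor on the point.\<close>
  define E where "E = F * (B + \<bar>lam\<bar> * F)"
  have energy: "U p t 0 (f p) \<in> op_dom (H (g t p)) \<and>
      cmod (cinner (U p t 0 (f p)) (op_app (H (g t p)) (U p t 0 (f p)))) \<le> E"
    if p: "\<forall>t. U p t 0 (f p) = cis (- lam * t) *\<^sub>C f (g t p)" for p t
  proof -
    have "\<exists>D. ((\<lambda>t. U p t 0 (f p)) has_vector_derivative D) (at t) \<and> norm D \<le> B + \<bar>lam\<bar> * F" for t
    proof -
      obtain D where D: "((\<lambda>s. f (g s p)) has_vector_derivative D) (at t)" "norm D \<le> B"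
        using B by blast
      define D' where "D' = cis (- lam * t) *\<^sub>C D + (- lam *\<^sub>R (\<i> * cis (- lam * t))) *\<^sub>C f (g t p)"
      have "((\<lambda>t. cis (- lam * t)) has_vector_derivative - lam *\<^sub>R (\<i> * cis (- lam * t))) (at t)"
        unfolding has_vector_derivative_def by (rule derivative_eq_intros refl | simp add: mult.commute)+
      from bounded_bilinear.has_vector_derivative[OF bounded_bilinear_scaleC this D(1)]
      have "((\<lambda>t. U p t 0 (f p)) has_vector_derivative D') (at t)"
        using p by (simp add: D'_def)
      moreover have "norm D' \<le> B + \<bar>lam\<bar> * F"
        unfolding D'_def using D(2) F[of "g t p"]
        by (intro norm_triangle_le add_mono) (simp_all add: norm_scaleC norm_mult mult_left_mono)
      ultimately show ?thesis by blast
    qed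
    then obtain D where D: "\<And>t. ((\<lambda>t. U p t 0 (f p)) has_vector_derivative D t) (at t)"
        "\<And>t. norm (D t) \<le> B + \<bar>lam\<bar> * F"
      by metis
    note * = energy_of_differentiable_orbit[OF assms(7) D, of t]
    \<comment> \<open>Nonnegativity of the second factor is read off from its being a bound for the
      norm of \<open>D 0\<close>.\<close>
    have "norm (f p) * (B + \<bar>lam\<bar> * F) \<le> E"
      unfolding E_def using F[of p] D(2)[of 0] norm_ge_zero[of "D 0"]
      by (intro mult_right_mono) linarith+
    with * show ?thesis by linarith
  qed
  show "AE \<theta> in M. (\<forall>t. U \<theta> t 0 (f \<theta>) \<in> op_dom (H (g t \<theta>))) \<and>
      bounded (range (\<lambda>t. cinner (U \<theta> t 0 (f \<theta>)) (op_app (H (g t \<theta>)) (U \<theta> t 0 (f \<theta>)))))"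
    using orbit
  proof eventually_elim
    case (elim p)
    then show ?case using energy[OF elim] unfolding bounded_iff by blast
  qed
  fix H0 :: "'h uop" and V :: "'m \<Rightarrow> 'h \<Rightarrow> 'h"
  assume asm: "self_adjoint H0 \<and> unbounded_op H0 \<and> positive_op H0 \<and> discrete_spectrum H0 \<and>
    (\<forall>\<theta>. clinear_on UNIV (V \<theta>) \<and> bounded_linear (V \<theta>)) \<and>
    bdd_above {onorm (V (g t \<theta>)) | t \<theta>. True} \<and>
    (\<forall>\<theta> t. is_op_sum (H (g t \<theta>)) H0 (V (g t \<theta>)))"
  then obtain C where C: "\<And>t p. onorm (V (g t p)) \<le> C"
    unfolding bdd_above_def by blast
  \<comment> \<open>The perturbed and unperturbed operators share their domain, so the state lies in
    \<open>op_dom H0\<close> and its \<open>H0\<close> energy differs from the total energy by the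
    expectation of \<open>V\<close>, which is at most \<open>F * (C * F)\<close>.\<close>
  have energy0: "cmod (cinner (U p t 0 (f p)) (op_app H0 (U p t 0 (f p)))) \<le> E + F * (C * F)"
    if p: "\<forall>t. U p t 0 (f p) = cis (- lam * t) *\<^sub>C f (g t p)" for p t
  proof -
    let ?u = "U p t 0 (f p)"
    have u: "norm ?u \<le> F" by (simp add: unitary_op_norm[OF unitary_U] F)
    have "?u \<in> op_dom H0" and "op_app (H (g t p)) ?u = op_app H0 ?u + V (g t p) ?u"
      using asm energy[OF p, of t] by (auto simp: is_op_sum_def)
    then have "cinner ?u (op_app H0 ?u) =
        cinner ?u (op_app (H (g t p)) ?u) - cinner ?u (V (g t p) ?u)"
      by (simp add: cinner_add_right)
    then have "cmod (cinner ?u (op_app H0 ?u)) \<le>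
        cmod (cinner ?u (op_app (H (g t p)) ?u)) + cmod (cinner ?u (V (g t p) ?u))"
      by (metis norm_triangle_ineq4)
    moreover have "cmod (cinner ?u (V (g t p) ?u)) \<le> F * (C * F)"
    proof -
      have V: "bounded_linear (V (g t p))" using asm by blast
      have "0 \<le> C" using onorm_pos_le[OF V] C order_trans by blast
      have "norm (V (g t p) ?u) \<le> onorm (V (g t p)) * norm ?u" by (rule onorm[OF V])
      also have "\<dots> \<le> C * F" using C u \<open>0 \<le> C\<close> by (intro mult_mono) auto
      finally have "norm ?u * norm (V (g t p) ?u) \<le> F * (C * F)"
        using u norm_ge_zero[of ?u] by (intro mult_mono) (linarith | simp)+
      with norm_cinner_le show ?thesis by (rule order_trans)
    qed
    ultimately show ?thesis using energy[OF p, of t] by linarith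
  qed
  \<comment> \<open>The exceptional null set is that of \<open>orbit\<close>, the same for every
    choice of \<open>H0\<close> and \<open>V\<close>.\<close>
  show "AE \<theta> in M.
      bounded (range (\<lambda>t. cinner (U \<theta> t 0 (f \<theta>)) (op_app H0 (U \<theta> t 0 (f \<theta>)))))"
    using orbit
  proof eventually_elim
    case (elim p)
    then show ?case using energy0[OF elim] unfolding bounded_iff by blast
  qed
qed

end
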